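(* Let $u\in\mathcal{D}(E)$ and suppose that $T=EM_u$, $Tf=E(uf)$, is a bounded operator on $L^2(\Sigma)$. If $S(E(u))=S(E(|u|^2))$, then the following conditions are equivalent: (1) $T$ is centered. (2) $T$ is normal. (3) $u\in L^\infty(\mathcal{A})$.
   Context: $(X,\Sigma,\mu)$ is a complete $\sigma$-finite measure space and $\mathcal{A}\subseteq\Sigma$ is a sub-$\sigma$-algebra such that $(X,\mathcal{A},\mu|_{\mathcal{A}})$ is $\sigma$-finite. $L^2(\Sigma)=L^2(X,\Sigma,\mu)$ (complex-valued functions) and $L^\infty(\mathcal{A})=L^\infty(X,\mathcal{A},\mu|_{\mathcal{A}})$. $L^0(\Sigma)$ is the space of a.e. classes of a.e. finite-valued $\Sigma$-measurable functions, and $L^0(\mathcal{A})$ is its analogue for $\mathcal{A}$. $E=E^{\mathcal{A}}$ is the conditional expectation with respect to $\mathcal{A}$: $E(f)$ is the unique $\mathcal{A}$-measurable function with $\int_A f\,d\mu=\int_A E(f)\,d\mu$ for $A\in\mathcal{A}$, for non-negative measurable $f$ and for $f\in L^2(\Sigma)$, and it extends in the usual way to $\mathcal{D}(E)=\{g\in L^0(\Sigma): E(|g|)\in L^0(\mathcal{A})\}$. $M_u$ denotes multiplication by $u$. The support of a measurable function $f$ is $S(f)=\{x\in X: f(x)\neq 0\}$. All equalities between functions or sets hold up to $\mu$-null sets. A bounded operator $A$ on a Hilbert space is normal if $A^*A=AA^*$, and centered if the family $\{A^{*n}A^n,\ A^kA^{*k}: n,k\ge 0\}$ is commutative. *)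

theory Defs
  imports "HOL-Probability.Conditional_Expectation"
begin

text \<open>
  A sub-sigma-algebra of \<open>M\<close> is represented by a measure \<open>F\<close> with \<open>subalgebra M F\<close>; only the
  sigma-algebra of \<open>F\<close> is relevant, and the measure it carries is \<open>restr_to_subalg M F\<close>.
  Elements of function spaces are represented by functions; equality in these spaces
  is equality almost everywhere.
\<close>

definition ae_eq :: "'a measure \<Rightarrow> ('a \<Rightarrow> complex) \<Rightarrow> ('a \<Rightarrow> complex) \<Rightarrow> bool" where
  "ae_eq M f g \<longleftrightarrow> (AE x in M. f x = g x)"

definition ae_eq_set :: "'a measure \<Rightarrow> 'a set \<Rightarrow> 'a set \<Rightarrow> bool" where
  "ae_eq_set M A B \<longleftrightarrow> (AE x in M. x \<in> A \<longleftrightarrow> x \<in> B)"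

definition supp :: "'a measure \<Rightarrow> ('a \<Rightarrow> 'b::zero) \<Rightarrow> 'a set" where
  "supp M f = {x \<in> space M. f x \<noteq> 0}"


section \<open>Spaces of complex-valued functions\<close>

definition L2 :: "'a measure \<Rightarrow> ('a \<Rightarrow> complex) set" where
  "L2 M = {f \<in> borel_measurable M. integrable M (\<lambda>x. (cmod (f x))\<^sup>2)}"

definition L2_inner :: "'a measure \<Rightarrow> ('a \<Rightarrow> complex) \<Rightarrow> ('a \<Rightarrow> complex) \<Rightarrow> complex" where
  "L2_inner M f g = (\<integral>x. f x * cnj (g x) \<partial>M)"

definition L2_norm :: "'a measure \<Rightarrow> ('a \<Rightarrow> complex) \<Rightarrow> real" where
  "L2_norm M f = sqrt (\<integral>x. (cmod (f x))\<^sup>2 \<partial>M)"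

definition Linf :: "'a measure \<Rightarrow> ('a \<Rightarrow> complex) set" where
  "Linf M = {f \<in> borel_measurable M. \<exists>C. AE x in M. cmod (f x) \<le> C}"


section \<open>Conditional expectation of complex-valued functions\<close>

definition cond_exp_domain :: "'a measure \<Rightarrow> 'a measure \<Rightarrow> ('a \<Rightarrow> complex) set" where
  "cond_exp_domain M F = {f \<in> borel_measurable M.
     AE x in M. nn_cond_exp M F (\<lambda>y. ennreal (cmod (f y))) x < \<infinity>}"

definition complex_cond_exp :: "'a measure \<Rightarrow> 'a measure \<Rightarrow> ('a \<Rightarrow> complex) \<Rightarrow> 'a \<Rightarrow> complex" where
  "complex_cond_exp M F f x =
     Complex (real_cond_exp M F (\<lambda>y. Re (f y)) x) (real_cond_exp M F (\<lambda>y. Im (f y)) x)"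


section \<open>Bounded operators on \<open>L2\<close>\<close>

text \<open>
  Linearity and boundedness together imply that the operator respects equality almost
  everywhere, hence acts on the space of classes.
\<close>

definition bounded_op :: "'a measure \<Rightarrow> (('a \<Rightarrow> complex) \<Rightarrow> ('a \<Rightarrow> complex)) \<Rightarrow> bool" where
  "bounded_op M T \<longleftrightarrow>
     (\<forall>f\<in>L2 M. T f \<in> L2 M) \<and>
     (\<forall>f\<in>L2 M. \<forall>g\<in>L2 M. ae_eq M (T (\<lambda>x. f x + g x)) (\<lambda>x. T f x + T g x)) \<and>
     (\<forall>c. \<forall>f\<in>L2 M. ae_eq M (T (\<lambda>x. c * f x)) (\<lambda>x. c * T f x)) \<and>
     (\<exists>C. \<forall>f\<in>L2 M. L2_norm M (T f) \<le> C * L2_norm M f)"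

definition op_eq :: "'a measure \<Rightarrow> (('a \<Rightarrow> complex) \<Rightarrow> ('a \<Rightarrow> complex)) \<Rightarrow>
    (('a \<Rightarrow> complex) \<Rightarrow> ('a \<Rightarrow> complex)) \<Rightarrow> bool" where
  "op_eq M A B \<longleftrightarrow> (\<forall>f\<in>L2 M. ae_eq M (A f) (B f))"

definition is_adjoint :: "'a measure \<Rightarrow> (('a \<Rightarrow> complex) \<Rightarrow> ('a \<Rightarrow> complex)) \<Rightarrow>
    (('a \<Rightarrow> complex) \<Rightarrow> ('a \<Rightarrow> complex)) \<Rightarrow> bool" where
  "is_adjoint M T S \<longleftrightarrow>
     bounded_op M S \<and> (\<forall>f\<in>L2 M. \<forall>g\<in>L2 M. L2_inner M (T f) g = L2_inner M f (S g))"

text \<open>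
  For a bounded operator the adjoint exists by the Riesz representation theorem and is unique
  up to \<open>op_eq\<close>; the choice operator only selects representatives of the image classes.
\<close>

definition adj :: "'a measure \<Rightarrow> (('a \<Rightarrow> complex) \<Rightarrow> ('a \<Rightarrow> complex)) \<Rightarrow>
    (('a \<Rightarrow> complex) \<Rightarrow> ('a \<Rightarrow> complex))" where
  "adj M T = (SOME S. is_adjoint M T S)"

definition normal_op :: "'a measure \<Rightarrow> (('a \<Rightarrow> complex) \<Rightarrow> ('a \<Rightarrow> complex)) \<Rightarrow> bool" where
  "normal_op M T \<longleftrightarrow> bounded_op M T \<and> op_eq M (adj M T \<circ> T) (T \<circ> adj M T)"

definition centered_family :: "'a measure \<Rightarrow> (('a \<Rightarrow> complex) \<Rightarrow> ('a \<Rightarrow> complex)) \<Rightarrow>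
    (('a \<Rightarrow> complex) \<Rightarrow> ('a \<Rightarrow> complex)) set" where
  "centered_family M T =
     range (\<lambda>n::nat. (adj M T ^^ n) \<circ> (T ^^ n)) \<union> range (\<lambda>k::nat. (T ^^ k) \<circ> (adj M T ^^ k))"

definition centered_op :: "'a measure \<Rightarrow> (('a \<Rightarrow> complex) \<Rightarrow> ('a \<Rightarrow> complex)) \<Rightarrow> bool" where
  "centered_op M T \<longleftrightarrow> bounded_op M T \<and>
     (\<forall>A\<in>centered_family M T. \<forall>B\<in>centered_family M T. op_eq M (A \<circ> B) (B \<circ> A))"

end

theory Submission
  imports Defs
begin

text \<open>
  Write \<open>E\<close> for the conditional expectation with respect to \<open>F\<close>, let \<open>T f = E (u f)\<close>, and call a
  function \<open>F\<close>-measurable if it is measurable for the sub-sigma-algebra. Since \<open>F\<close>-measurable factors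
  can be pulled out of \<open>E\<close>, the adjoint is \<open>T\<^sup>* g = cnj u \<cdot> E g\<close>, and
  \<open>T T\<^sup>* g = E|u|\<^sup>2 \<cdot> E g\<close> while \<open>T\<^sup>* T g = cnj u \<cdot> E (u g)\<close>.
  The equivalence follows from the cycle: \<open>u\<close> is \<open>F\<close>-measurable and bounded, hence \<open>T\<close> is normal,
  hence \<open>T\<close> is centered, hence \<open>u\<close> is \<open>F\<close>-measurable and bounded.

  If \<open>u\<close> agrees with an \<open>F\<close>-measurable function, it can itself be pulled out of \<open>E\<close>, and both products
  become \<open>g \<mapsto> |u|\<^sup>2 \<cdot> E g\<close> (\<open>F_measurable_imp_normal\<close>). A normal operator is always centered, because
  the members of the family are words in two commuting letters (\<open>normal_op_centered\<close>).

  For the remaining implication it suffices that \<open>T\<^sup>* T\<close> and \<open>T T\<^sup>*\<close> commute, tested at a single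
  nowhere vanishing \<open>F\<close>-measurable \<open>q\<close> in \<open>L\<^sup>2\<close>:
  \<open>T\<^sup>* T T T\<^sup>* q = cnj u \<cdot> E|u|\<^sup>2 \<cdot> E u \<cdot> q\<close> and
  \<open>T T\<^sup>* T\<^sup>* T q = cnj (E u) \<cdot> E|u|\<^sup>2 \<cdot> E u \<cdot> q\<close>.
  Where \<open>E u\<close> is nonzero, the hypothesis on supports makes \<open>E|u|\<^sup>2\<close> nonzero as well, so the common
  factors cancel and \<open>u = E u\<close>; elsewhere \<open>E|u|\<^sup>2 = 0\<close>, which forces \<open>u = 0 = E u\<close>. Thus \<open>u = E u\<close>
  almost everywhere (\<open>commuting_imp_F_measurable\<close>), and \<open>E u\<close> is bounded because \<open>T\<close> acts on
  \<open>F\<close>-measurable functions as multiplication by it (\<open>E_u_bounded\<close>).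

  Two analytic points need care. First, functions in the domain of \<open>E\<close>, and even those in \<open>L\<^sup>2\<close>, need
  not be integrable; they become so after multiplication by a positive \<open>F\<close>-measurable weight, which can
  be cancelled again (\<open>cond_exp_domain_weight\<close>). Secondly, \<open>T\<^sup>*\<close> must be shown to map \<open>L\<^sup>2\<close>
  boundedly into itself. This follows from the boundedness of \<open>T\<close> by testing the duality
  between \<open>T\<close> and the explicit formula for \<open>T\<^sup>*\<close> against truncations of \<open>T\<^sup>* g\<close>
  (\<open>T_star_L2_bound\<close>).
\<close>

section \<open>Square-integrable functions and operators on them\<close>

lemma L2_measurable [measurable_dest]: "f \<in> L2 M \<Longrightarrow> f \<in> borel_measurable M"
  by (simp add: L2_def)

lemma L2_integrable: "f \<in> L2 M \<Longrightarrow> integrable M (\<lambda>x. (cmod (f x))\<^sup>2)"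
  by (simp add: L2_def)

lemma L2_I: "f \<in> borel_measurable M \<Longrightarrow> integrable M (\<lambda>x. (cmod (f x))\<^sup>2) \<Longrightarrow> f \<in> L2 M"
  by (simp add: L2_def)

lemma L2_bound:
  assumes "f \<in> borel_measurable M" "g \<in> L2 M" "AE x in M. cmod (f x) \<le> cmod (g x)"
  shows "f \<in> L2 M"
proof (rule L2_I[OF assms(1)])
  note [measurable] = assms(1) L2_measurable[OF assms(2)]
  show "integrable M (\<lambda>x. (cmod (f x))\<^sup>2)"
    by (rule Bochner_Integration.integrable_bound[OF L2_integrable[OF assms(2)]])
       (use assms(3) in \<open>auto intro: power_mono\<close>)
qed

lemma L2_diff:
  assumes "f \<in> L2 M" "g \<in> L2 M"
  shows "(\<lambda>x. f x - g x) \<in> L2 M"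
proof (rule L2_I)
  note [measurable] = L2_measurable[OF assms(1)] L2_measurable[OF assms(2)]
  show "(\<lambda>x. f x - g x) \<in> borel_measurable M" by measurable
  have *: "(cmod (a - b))\<^sup>2 \<le> 2 * (cmod a)\<^sup>2 + 2 * (cmod b)\<^sup>2" for a b
  proof -
    have "(cmod (a - b))\<^sup>2 \<le> (cmod a + cmod b)\<^sup>2"
      by (intro power_mono norm_triangle_ineq4) auto
    also have "\<dots> \<le> 2 * (cmod a)\<^sup>2 + 2 * (cmod b)\<^sup>2"
      using sum_squares_bound[of "cmod a" "cmod b"] by (simp add: power2_sum)
    finally show ?thesis .
  qed
  have "integrable M (\<lambda>x. 2 * (cmod (f x))\<^sup>2 + 2 * (cmod (g x))\<^sup>2)"
    using L2_integrable[OF assms(1)] L2_integrable[OF assms(2)] by simp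
  then show "integrable M (\<lambda>x. (cmod (f x - g x))\<^sup>2)"
    by (rule Bochner_Integration.integrable_bound) (use * in auto)
qed

lemma L2_mult_integrable:
  assumes "f \<in> L2 M" "g \<in> L2 M"
  shows "integrable M (\<lambda>x. f x * g x)"
proof -
  note [measurable] = L2_measurable[OF assms(1)] L2_measurable[OF assms(2)]
  have *: "cmod a * cmod b \<le> (cmod a)\<^sup>2 + (cmod b)\<^sup>2" for a b
    using sum_squares_bound[of "cmod a" "cmod b"] mult_nonneg_nonneg[OF norm_ge_zero norm_ge_zero, of a b]
    by linarith
  have "integrable M (\<lambda>x. (cmod (f x))\<^sup>2 + (cmod (g x))\<^sup>2)"
    using L2_integrable[OF assms(1)] L2_integrable[OF assms(2)] by simp
  then show ?thesis
    by (rule Bochner_Integration.integrable_bound) (use * in \<open>auto simp: norm_mult\<close>)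
qed

lemma borel_measurable_cnj [measurable (raw)]:
  "f \<in> borel_measurable M \<Longrightarrow> (\<lambda>x. cnj (f x)) \<in> borel_measurable M"
  by (simp add: borel_measurable_complex_iff)

lemma L2_cnj: "f \<in> L2 M \<Longrightarrow> (\<lambda>x. cnj (f x)) \<in> L2 M"
  by (auto simp: L2_def intro: borel_measurable_cnj)

lemma L2_self_zero_AE:
  assumes "f \<in> L2 M" "(\<integral>x. (cmod (f x))\<^sup>2 \<partial>M) \<le> 0"
  shows "AE x in M. f x = 0"
proof -
  have "(\<integral>x. (cmod (f x))\<^sup>2 \<partial>M) = 0"
    using assms(2) by (intro antisym) auto
  then show ?thesis
    using integral_nonneg_eq_0_iff_AE[OF L2_integrable[OF assms(1)]] by auto
qed

lemma bounded_op_integral_bound: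
  assumes "bounded_op M T"
  obtains C where "C \<ge> 1"
    "\<And>f. f \<in> L2 M \<Longrightarrow> (\<integral>x. (cmod (T f x))\<^sup>2 \<partial>M) \<le> C * (\<integral>x. (cmod (f x))\<^sup>2 \<partial>M)"
proof -
  obtain K where K: "\<And>f. f \<in> L2 M \<Longrightarrow> L2_norm M (T f) \<le> K * L2_norm M f"
    using assms unfolding bounded_op_def by blast
  have "(\<integral>x. (cmod (T f x))\<^sup>2 \<partial>M) \<le> max 1 (K\<^sup>2) * (\<integral>x. (cmod (f x))\<^sup>2 \<partial>M)" if "f \<in> L2 M" for f
  proof -
    have "(L2_norm M (T f))\<^sup>2 \<le> (K * L2_norm M f)\<^sup>2"
      using K[OF that] by (intro power_mono) (auto simp: L2_norm_def)
    then have "(\<integral>x. (cmod (T f x))\<^sup>2 \<partial>M) \<le> K\<^sup>2 * (\<integral>x. (cmod (f x))\<^sup>2 \<partial>M)"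
      by (simp add: L2_norm_def power_mult_distrib)
    also have "\<dots> \<le> max 1 (K\<^sup>2) * (\<integral>x. (cmod (f x))\<^sup>2 \<partial>M)"
      by (intro mult_right_mono) auto
    finally show ?thesis .
  qed
  then show ?thesis using that[of "max 1 (K\<^sup>2)"] by auto
qed

text \<open>
  Operators act on functions rather than on classes modulo null sets; this predicate says that an
  operator descends to such classes. Unlike boundedness, it makes no reference to addition or norms,
  and it is inherited by composites and powers.
\<close>
definition L2_respecting :: "'a measure \<Rightarrow> (('a \<Rightarrow> complex) \<Rightarrow> ('a \<Rightarrow> complex)) \<Rightarrow> bool" where
  "L2_respecting M A \<longleftrightarrow> (\<forall>f\<in>L2 M. A f \<in> L2 M) \<and>
     (\<forall>f\<in>L2 M. \<forall>g\<in>L2 M. (AE x in M. f x = g x) \<longrightarrow> (AE x in M. A f x = A g x))"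

text \<open>
  A bounded operator maps a square-integrable null function to a null function, since it does not
  increase the norm by more than a constant factor; additivity carries this over to differences.
\<close>
lemma bounded_op_respecting:
  assumes "bounded_op M T"
  shows "L2_respecting M T"
  unfolding L2_respecting_def
proof (intro conjI ballI impI)
  show "T f \<in> L2 M" if "f \<in> L2 M" for f
    using assms that by (simp add: bounded_op_def)
next
  fix f g assume fg: "f \<in> L2 M" "g \<in> L2 M" "AE x in M. f x = g x"
  define d where "d = (\<lambda>x. f x - g x)"
  have d: "d \<in> L2 M" "T d \<in> L2 M"
    using L2_diff[OF fg(1,2)] assms by (simp_all add: d_def bounded_op_def)
  obtain C where C: "C \<ge> 1"
    "\<And>f. f \<in> L2 M \<Longrightarrow> (\<integral>x. (cmod (T f x))\<^sup>2 \<partial>M) \<le> C * (\<integral>x. (cmod (f x))\<^sup>2 \<partial>M)"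
    using bounded_op_integral_bound[OF assms] by metis
  have "(\<integral>x. (cmod (d x))\<^sup>2 \<partial>M) = 0"
    by (rule integral_eq_zero_AE) (use fg(3) in \<open>auto simp: d_def\<close>)
  then have "AE x in M. T d x = 0"
    using C(2)[OF d(1)] by (intro L2_self_zero_AE[OF d(2)]) simp
  moreover have "AE x in M. T (\<lambda>x. g x + d x) x = T g x + T d x"
    using assms fg d by (simp add: bounded_op_def ae_eq_def)
  moreover have "(\<lambda>x. g x + d x) = f" by (simp add: d_def)
  ultimately show "AE x in M. T f x = T g x" by auto
qed

lemma L2_respecting_comp: "L2_respecting M A \<Longrightarrow> L2_respecting M B \<Longrightarrow> L2_respecting M (A \<circ> B)"
  by (auto simp: L2_respecting_def)

lemma L2_respecting_funpow: "L2_respecting M A \<Longrightarrow> L2_respecting M (A ^^ n)"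
  by (induction n) (auto simp: L2_respecting_def)

text \<open>
  Composites are compared only up to null sets, so moving \<open>A\<close> past \<open>C\<close> underneath \<open>B\<close>
  is legitimate only because \<open>B\<close> does not see changes on null sets.
\<close>
lemma commute_comp:
  assumes A: "L2_respecting M A" and B: "L2_respecting M B" and C: "L2_respecting M C"
    and AB: "op_eq M (A \<circ> B) (B \<circ> A)" and AC: "op_eq M (A \<circ> C) (C \<circ> A)"
  shows "op_eq M (A \<circ> (B \<circ> C)) ((B \<circ> C) \<circ> A)"
  unfolding op_eq_def ae_eq_def
proof
  fix f assume f: "f \<in> L2 M"
  have "AE x in M. A (B (C f)) x = B (A (C f)) x"
    using AB C f by (auto simp: op_eq_def ae_eq_def L2_respecting_def)
  moreover have "AE x in M. A (C f) x = C (A f) x"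
    using AC f by (auto simp: op_eq_def ae_eq_def)
  then have "AE x in M. B (A (C f)) x = B (C (A f)) x"
    using A B C f by (auto simp: L2_respecting_def)
  ultimately show "AE x in M. (A \<circ> (B \<circ> C)) f x = ((B \<circ> C) \<circ> A) f x" by auto
qed

lemma commute_sym: "op_eq M (A \<circ> B) (B \<circ> A) \<Longrightarrow> op_eq M (B \<circ> A) (A \<circ> B)"
  by (auto simp: op_eq_def ae_eq_def)

lemma commute_funpow:
  assumes A: "L2_respecting M A" and B: "L2_respecting M B"
    and AB: "op_eq M (A \<circ> B) (B \<circ> A)"
  shows "op_eq M (A \<circ> (B ^^ n)) ((B ^^ n) \<circ> A)"
proof (induction n)
  case 0
  then show ?case by (simp add: op_eq_def ae_eq_def)
next
  case (Suc n)
  from commute_comp[OF A B L2_respecting_funpow[OF B] AB Suc] show ?case by (simp only: funpow.simps)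
qed

text \<open>
  Every member of the family is a word in the letters \<open>T\<close> and \<open>adj M T\<close>. Normality says that these
  letters commute, hence each letter commutes with each word, hence any two words commute.
\<close>
lemma normal_op_centered:
  assumes T: "bounded_op M T" and adj: "is_adjoint M T (adj M T)" and normal: "normal_op M T"
  shows "centered_op M T"
proof -
  let ?S = "adj M T"
  have R: "L2_respecting M T" "L2_respecting M ?S"
    using T adj by (auto simp: is_adjoint_def intro: bounded_op_respecting)
  have ST: "op_eq M (?S \<circ> T) (T \<circ> ?S)" using normal by (simp add: normal_op_def)
  have words: "\<exists>B\<in>{T, ?S}. \<exists>C\<in>{T, ?S}. \<exists>n. A = (B ^^ n) \<circ> (C ^^ n)" if "A \<in> centered_family M T" for A
    using that unfolding centered_family_def by blast
  have resp: "L2_respecting M A" if "A \<in> centered_family M T" for A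
    using words[OF that] R by (auto intro!: L2_respecting_comp L2_respecting_funpow)
  have gen: "op_eq M (B \<circ> C) (C \<circ> B)" if "B \<in> {T, ?S}" "C \<in> {T, ?S}" for B C
    using that ST commute_sym[OF ST] by (auto simp: op_eq_def ae_eq_def)
  have letter: "op_eq M (B \<circ> A) (A \<circ> B)" if A: "A \<in> centered_family M T" and B: "B \<in> {T, ?S}" for A B
  proof -
    obtain C D n where CD: "C \<in> {T, ?S}" "D \<in> {T, ?S}" "A = (C ^^ n) \<circ> (D ^^ n)"
      using words[OF A] by blast
    have r: "L2_respecting M B" "L2_respecting M C" "L2_respecting M D" using R B CD by auto
    show ?thesis unfolding CD(3)
      by (rule commute_comp[OF r(1) L2_respecting_funpow[OF r(2)] L2_respecting_funpow[OF r(3)]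
            commute_funpow[OF r(1,2) gen[OF B CD(1)]] commute_funpow[OF r(1,3) gen[OF B CD(2)]]])
  qed
  have "op_eq M (A \<circ> B) (B \<circ> A)" if A: "A \<in> centered_family M T" and B: "B \<in> centered_family M T" for A B
  proof -
    obtain C D n where CD: "C \<in> {T, ?S}" "D \<in> {T, ?S}" "B = (C ^^ n) \<circ> (D ^^ n)"
      using words[OF B] by blast
    have r: "L2_respecting M A" "L2_respecting M C" "L2_respecting M D" using R CD resp[OF A] by auto
    note comm = letter[OF A CD(1), THEN commute_sym] letter[OF A CD(2), THEN commute_sym]
    show ?thesis unfolding CD(3)
      by (rule commute_comp[OF r(1) L2_respecting_funpow[OF r(2)] L2_respecting_funpow[OF r(3)]
            commute_funpow[OF r(1,2) comm(1)] commute_funpow[OF r(1,3) comm(2)]])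
  qed
  then show ?thesis using T by (simp add: centered_op_def)
qed

text \<open>
  If both operators are adjoint to \<open>T\<close>, the difference \<open>h\<close> of their values at \<open>f\<close> is orthogonal
  to every element of \<open>L2 M\<close>, in particular to itself.
\<close>
lemma adjoint_unique:
  assumes "is_adjoint M T S" "is_adjoint M T S'" "f \<in> L2 M"
  shows "AE x in M. S f x = S' f x"
proof -
  define h where "h = (\<lambda>x. S f x - S' f x)"
  have L: "S f \<in> L2 M" "S' f \<in> L2 M"
    using assms by (simp_all add: is_adjoint_def bounded_op_def)
  then have h: "h \<in> L2 M" unfolding h_def by (rule L2_diff)
  have "L2_inner M (T h) f = L2_inner M h (S f)" "L2_inner M (T h) f = L2_inner M h (S' f)"
    using assms h by (simp_all add: is_adjoint_def)
  then have "L2_inner M h (S f) = L2_inner M h (S' f)" by simp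
  then have "(\<integral>x. h x * cnj (S f x) - h x * cnj (S' f x) \<partial>M) = 0"
    using L2_mult_integrable[OF h L2_cnj[OF L(1)]] L2_mult_integrable[OF h L2_cnj[OF L(2)]]
    by (simp add: L2_inner_def)
  moreover have "h x * cnj (S f x) - h x * cnj (S' f x) = complex_of_real ((cmod (h x))\<^sup>2)" for x
    by (simp only: complex_norm_square h_def) (simp add: algebra_simps)
  ultimately have "(\<integral>x. (cmod (h x))\<^sup>2 \<partial>M) = 0"
    by (metis (no_types, lifting) Bochner_Integration.integral_cong integral_complex_of_real of_real_eq_0_iff)
  then show ?thesis using L2_self_zero_AE[OF h] by (auto simp: h_def)
qed

section \<open>Conditional expectation of complex functions that need not be integrable\<close>

context sigma_finite_subalgebra
begin

lemma borel_measurable_F_M: "f \<in> borel_measurable F \<Longrightarrow> f \<in> borel_measurable M"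
  using measurable_from_subalg[OF subalg] .

lemma complex_cond_exp_measurable [measurable]:
  "complex_cond_exp M F f \<in> borel_measurable F" "complex_cond_exp M F f \<in> borel_measurable M"
  by (simp_all add: borel_measurable_complex_iff complex_cond_exp_def)

lemma complex_cond_exp_cong:
  assumes "AE x in M. f x = g x" and [measurable]: "f \<in> borel_measurable M" "g \<in> borel_measurable M"
  shows "AE x in M. complex_cond_exp M F f x = complex_cond_exp M F g x"
proof -
  have "AE x in M. real_cond_exp M F (\<lambda>y. Re (f y)) x = real_cond_exp M F (\<lambda>y. Re (g y)) x"
    "AE x in M. real_cond_exp M F (\<lambda>y. Im (f y)) x = real_cond_exp M F (\<lambda>y. Im (g y)) x"
    by (rule real_cond_exp_cong, rule eventually_mono[OF assms(1)], simp_all)+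
  then show ?thesis by (auto simp: complex_cond_exp_def)
qed

lemma complex_cond_exp_cnj:
  "complex_cond_exp M F (\<lambda>x. cnj (f x)) x = cnj (complex_cond_exp M F f x)"
  by (simp add: complex_cond_exp_def real_cond_exp_def complex_eq_iff)

text \<open>
  Each of the four products of real and imaginary parts is dominated by \<open>h f\<close>, so the real
  statement \<open>real_cond_exp_mult\<close> applies to all of them. Integrability is imposed on the product
  in order to cover integrable multiples of a function that is not integrable itself.
\<close>
lemma complex_cond_exp_mult_integrable:
  fixes h f :: "'a \<Rightarrow> complex"
  assumes h: "h \<in> borel_measurable F" and [measurable]: "f \<in> borel_measurable M"
    and int: "integrable M (\<lambda>x. h x * f x)"
  shows "AE x in M. complex_cond_exp M F (\<lambda>x. h x * f x) x = h x * complex_cond_exp M F f x"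
proof -
  note [measurable] = h borel_measurable_F_M[OF h]
  have bound: "\<bar>a\<bar> * \<bar>b\<bar> \<le> cmod (w * z)"
    if "\<bar>a\<bar> \<le> cmod w" "\<bar>b\<bar> \<le> cmod z" for a b and w z :: complex
    using that by (auto simp: norm_mult intro: mult_mono)
  have i: "integrable M (\<lambda>x. Re (h x) * Re (f x))" "integrable M (\<lambda>x. Im (h x) * Im (f x))"
    "integrable M (\<lambda>x. Re (h x) * Im (f x))" "integrable M (\<lambda>x. Im (h x) * Re (f x))"
    by (rule Bochner_Integration.integrable_bound[OF int];
        auto simp: abs_mult intro!: bound abs_Re_le_cmod abs_Im_le_cmod)+
  have m: "(\<lambda>x. Re (h x)) \<in> borel_measurable F" "(\<lambda>x. Im (h x)) \<in> borel_measurable F"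
    "(\<lambda>x. Re (f x)) \<in> borel_measurable M" "(\<lambda>x. Im (f x)) \<in> borel_measurable M"
    by measurable
  show ?thesis
    using real_cond_exp_mult[OF m(1,3) i(1)] real_cond_exp_mult[OF m(2,4) i(2)]
      real_cond_exp_mult[OF m(1,4) i(3)] real_cond_exp_mult[OF m(2,3) i(4)]
      real_cond_exp_diff[OF i(1,2)] real_cond_exp_add[OF i(3,4)]
    by eventually_elim (simp add: complex_cond_exp_def complex_eq_iff)
qed

lemma complex_cond_exp_integral:
  assumes "integrable M f"
  shows "integrable M (complex_cond_exp M F f)"
    and "(\<integral>x. complex_cond_exp M F f x \<partial>M) = (\<integral>x. f x \<partial>M)"
proof -
  let ?R = "real_cond_exp M F (\<lambda>x. Re (f x))" and ?I = "real_cond_exp M F (\<lambda>x. Im (f x))"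
  have i: "integrable M (\<lambda>x. Re (f x))" "integrable M (\<lambda>x. Im (f x))"
    using assms by auto
  have e: "complex_cond_exp M F f = (\<lambda>x. complex_of_real (?R x) + \<i> * complex_of_real (?I x))"
    by (auto simp: complex_cond_exp_def complex_eq_iff)
  have j: "integrable M ?R" "integrable M ?I"
    using real_cond_exp_int(1)[OF i(1)] real_cond_exp_int(1)[OF i(2)] .
  show int: "integrable M (complex_cond_exp M F f)"
    unfolding e using j by simp
  have "(\<integral>x. Re (complex_cond_exp M F f x) \<partial>M) = (\<integral>x. Re (f x) \<partial>M)"
    "(\<integral>x. Im (complex_cond_exp M F f x) \<partial>M) = (\<integral>x. Im (f x) \<partial>M)"
    using real_cond_exp_int(2)[OF i(1)] real_cond_exp_int(2)[OF i(2)]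
    by (simp_all add: complex_cond_exp_def)
  then show "(\<integral>x. complex_cond_exp M F f x \<partial>M) = (\<integral>x. f x \<partial>M)"
    using int assms by (intro complex_eqI) (simp_all add: integral_Re integral_Im)
qed

lemma complex_cond_exp_intg:
  fixes h f :: "'a \<Rightarrow> complex"
  assumes h: "h \<in> borel_measurable F" and f: "f \<in> borel_measurable M"
    and int: "integrable M (\<lambda>x. h x * f x)"
  shows "(\<integral>x. h x * complex_cond_exp M F f x \<partial>M) = (\<integral>x. h x * f x \<partial>M)"
proof -
  note [measurable] = f h borel_measurable_F_M[OF h]
  have "(\<integral>x. h x * complex_cond_exp M F f x \<partial>M) = (\<integral>x. complex_cond_exp M F (\<lambda>x. h x * f x) x \<partial>M)"
    using complex_cond_exp_mult_integrable[OF assms] by (intro integral_cong_AE) auto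
  then show ?thesis using complex_cond_exp_integral(2)[OF int] by simp
qed

text \<open>
  The nonnegative conditional expectation reproduces the positive and the negative part of a
  function separately, whether or not they are integrable.
\<close>
lemma complex_cond_exp_F_meas:
  assumes "f \<in> borel_measurable F"
  shows "AE x in M. complex_cond_exp M F f x = f x"
proof -
  have *: "AE x in M. real_cond_exp M F g x = g x" if [measurable]: "g \<in> borel_measurable F" for g
  proof -
    have "AE x in M. ennreal (g x) = nn_cond_exp M F (\<lambda>x. ennreal (g x)) x"
      "AE x in M. ennreal (- g x) = nn_cond_exp M F (\<lambda>x. ennreal (- g x)) x"
      by (intro nn_cond_exp_F_meas; measurable)+
    then show ?thesis
    proof eventually_elim
      case (elim x)
      show ?case
        unfolding real_cond_exp_def
        by (cases "0 \<le> g x") (simp_all add: ennreal_neg flip: elim)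
    qed
  qed
  have "(\<lambda>x. Re (f x)) \<in> borel_measurable F" "(\<lambda>x. Im (f x)) \<in> borel_measurable F"
    using assms by (auto simp: borel_measurable_complex_iff)
  from this[THEN *] show ?thesis by (auto simp: complex_cond_exp_def complex_eq_iff)
qed

lemma cond_exp_domain_measurable: "f \<in> cond_exp_domain M F \<Longrightarrow> f \<in> borel_measurable M"
  by (simp add: cond_exp_domain_def)

lemma cond_exp_domain_bound:
  assumes "g \<in> cond_exp_domain M F" "f \<in> borel_measurable M" "AE x in M. cmod (f x) \<le> cmod (g x)"
  shows "f \<in> cond_exp_domain M F"
proof -
  note [measurable] = assms(2) cond_exp_domain_measurable[OF assms(1)]
  have "AE x in M. nn_cond_exp M F (\<lambda>x. ennreal (cmod (f x))) x \<le> nn_cond_exp M F (\<lambda>x. ennreal (cmod (g x))) x"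
    using assms(3) by (intro nn_cond_exp_mono) auto
  then have "AE x in M. nn_cond_exp M F (\<lambda>x. ennreal (cmod (f x))) x < \<infinity>"
    using assms(1) unfolding cond_exp_domain_def by (auto elim: AE_mp intro: le_less_trans)
  then show ?thesis using assms(2) by (simp add: cond_exp_domain_def)
qed

text \<open>
  On an infinite measure space a square-integrable function need not be integrable, but
  \<open>|f| \<le> 1 + |f|\<^sup>2\<close>, and the conditional expectation of \<open>|f|\<^sup>2\<close> is finite almost everywhere because
  its integral is.
\<close>
lemma L2_cond_exp_domain:
  assumes "f \<in> L2 M"
  shows "f \<in> cond_exp_domain M F"
proof -
  note [measurable] = L2_measurable[OF assms]
  let ?s = "\<lambda>x. ennreal ((cmod (f x))\<^sup>2)"
  have "(\<integral>\<^sup>+x. nn_cond_exp M F ?s x \<partial>M) = (\<integral>\<^sup>+x. ?s x \<partial>M)"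
    using nn_cond_exp_intg[of "\<lambda>_. 1" ?s] by simp
  also have "\<dots> < \<infinity>" using L2_integrable[OF assms] by (simp add: integrable_iff_bounded)
  finally have 1: "AE x in M. nn_cond_exp M F ?s x \<noteq> \<infinity>"
    by (intro nn_integral_PInf_AE) auto
  have "cmod z \<le> 1 + (cmod z)\<^sup>2" for z
    using sum_squares_bound[of "cmod z" 1] norm_ge_zero[of z] unfolding power_one by linarith
  then have "AE x in M. nn_cond_exp M F (\<lambda>x. ennreal (cmod (f x))) x \<le> nn_cond_exp M F (\<lambda>x. 1 + ?s x) x"
    by (intro nn_cond_exp_mono AE_I2) (auto simp flip: ennreal_1 ennreal_plus intro: ennreal_leI)
  moreover have "AE x in M. nn_cond_exp M F (\<lambda>_. 1) x + nn_cond_exp M F ?s x = nn_cond_exp M F (\<lambda>x. 1 + ?s x) x"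
    by (intro nn_cond_exp_sum) auto
  moreover have "AE x in M. 1 = nn_cond_exp M F (\<lambda>_. 1) x"
    by (intro nn_cond_exp_F_meas) auto
  ultimately have "AE x in M. nn_cond_exp M F (\<lambda>x. ennreal (cmod (f x))) x < \<infinity>"
    using 1
  proof eventually_elim
    case (elim x)
    have "nn_cond_exp M F (\<lambda>x. ennreal (cmod (f x))) x \<le> 1 + nn_cond_exp M F ?s x"
      using elim(1,2,3) by simp
    also have "\<dots> < \<infinity>" using elim(4) by (simp add: less_top)
    finally show ?case .
  qed
  then show ?thesis by (simp add: cond_exp_domain_def)
qed

lemma positive_integrable_F_measurable:
  obtains q :: "'a \<Rightarrow> real" where "q \<in> borel_measurable F" "integrable M q" "\<And>x. x \<in> space M \<Longrightarrow> 0 < q x"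
proof -
  interpret R: sigma_finite_measure "restr_to_subalg M F" by (rule sigma_fin_subalg)
  obtain h where h: "h \<in> borel_measurable (restr_to_subalg M F)"
    "(\<integral>\<^sup>+x. h x \<partial>restr_to_subalg M F) \<noteq> \<infinity>"
    "\<forall>x\<in>space (restr_to_subalg M F). 0 < h x \<and> h x < \<infinity>"
    using R.Ex_finite_integrable_function by auto
  have hF [measurable]: "h \<in> borel_measurable F" using measurable_in_subalg'[OF subalg h(1)] .
  note [measurable] = borel_measurable_F_M[OF hF]
  have fin: "0 < h x \<and> h x < \<infinity>" if "x \<in> space M" for x
    using h(3) that by (simp add: space_restr_to_subalg)
  have "(\<integral>\<^sup>+x. ennreal (norm (enn2real (h x))) \<partial>M) = (\<integral>\<^sup>+x. h x \<partial>M)"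
    using fin by (intro nn_integral_cong) auto
  also have "\<dots> < \<infinity>" using h(2) nn_integral_subalgebra2[OF subalg hF] by (simp add: less_top)
  finally have "integrable M (\<lambda>x. enn2real (h x))" by (simp add: integrable_iff_bounded)
  moreover have "(\<lambda>x. enn2real (h x)) \<in> borel_measurable F" by measurable
  moreover have "0 < enn2real (h x)" if "x \<in> space M" for x
    using fin[OF that] by (simp add: enn2real_positive_iff)
  ultimately show ?thesis by (intro that[of "\<lambda>x. enn2real (h x)"])
qed

text \<open>
  This reduces statements about the domain of the conditional expectation to integrable functions.
  If \<open>q\<close> is a positive integrable function that is measurable with respect to \<open>F\<close>, then
  \<open>p = q / (1 + E|f|)\<close> satisfies \<open>\<integral> p |f| = \<integral> p E|f| \<le> \<integral> q\<close>. As \<open>p\<close> is positive and can be pulled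
  out of a conditional expectation, an identity for \<open>p f\<close> can be divided by \<open>p\<close>.
\<close>
lemma cond_exp_domain_weight:
  assumes "f \<in> cond_exp_domain M F"
  obtains p :: "'a \<Rightarrow> real" where "p \<in> borel_measurable F" "\<And>x. x \<in> space M \<Longrightarrow> 0 < p x"
    "integrable M (\<lambda>x. complex_of_real (p x) * f x)"
proof -
  obtain q :: "'a \<Rightarrow> real" where q: "q \<in> borel_measurable F" "integrable M q" "\<And>x. x \<in> space M \<Longrightarrow> 0 < q x"
    using positive_integrable_F_measurable by blast
  let ?e = "nn_cond_exp M F (\<lambda>x. ennreal (cmod (f x)))"
  define p where "p = (\<lambda>x. q x / (1 + enn2real (?e x)))"
  note [measurable] = cond_exp_domain_measurable[OF assms] q(1)
  have pF [measurable]: "p \<in> borel_measurable F" unfolding p_def by measurable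
  note [measurable] = borel_measurable_F_M[OF pF]
  have pos: "0 < p x" if "x \<in> space M" for x
    unfolding p_def using q(3)[OF that] by (intro divide_pos_pos) (auto simp: add_pos_nonneg)
  have "(\<integral>\<^sup>+x. ennreal (norm (complex_of_real (p x) * f x)) \<partial>M) = (\<integral>\<^sup>+x. ennreal (p x) * ennreal (cmod (f x)) \<partial>M)"
    using pos by (intro nn_integral_cong) (auto simp: norm_mult ennreal_mult less_imp_le)
  also have "\<dots> = (\<integral>\<^sup>+x. ennreal (p x) * ?e x \<partial>M)"
    by (rule nn_cond_exp_intg[symmetric]) measurable
  also have "\<dots> \<le> (\<integral>\<^sup>+x. ennreal (q x) \<partial>M)"
  proof (rule nn_integral_mono_AE)
    have "AE x in M. ?e x < \<infinity>" using assms by (simp add: cond_exp_domain_def)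
    moreover have "AE x in M. x \<in> space M" by auto
    ultimately show "AE x in M. ennreal (p x) * ?e x \<le> ennreal (q x)"
    proof eventually_elim
      case (elim x)
      define r where "r = enn2real (?e x)"
      have r: "?e x = ennreal r" "0 \<le> r" using elim(1) by (auto simp: r_def)
      have "p x * r \<le> q x"
        using q(3)[OF elim(2)] r(2) by (simp add: p_def r_def[symmetric] field_simps)
      then show ?case
        using pos[OF elim(2)] r by (simp add: ennreal_mult[symmetric] ennreal_leI)
    qed
  qed
  also have "\<dots> = (\<integral>\<^sup>+x. ennreal (norm (q x)) \<partial>M)"
    using q(3) by (intro nn_integral_cong) (auto simp: less_imp_le)
  also have "\<dots> < \<infinity>" using q(2) by (simp add: integrable_iff_bounded)
  finally have "integrable M (\<lambda>x. complex_of_real (p x) * f x)" by (simp add: integrable_iff_bounded)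
  with pF pos show ?thesis using that by blast
qed

lemma complex_cond_exp_mult:
  fixes h f :: "'a \<Rightarrow> complex"
  assumes h: "h \<in> borel_measurable F" and f: "f \<in> borel_measurable M"
    and hf: "(\<lambda>x. h x * f x) \<in> cond_exp_domain M F"
  shows "AE x in M. complex_cond_exp M F (\<lambda>x. h x * f x) x = h x * complex_cond_exp M F f x"
proof -
  obtain p :: "'a \<Rightarrow> real" where p: "p \<in> borel_measurable F" "\<And>x. x \<in> space M \<Longrightarrow> 0 < p x"
    "integrable M (\<lambda>x. complex_of_real (p x) * (h x * f x))"
    using cond_exp_domain_weight[OF hf] by blast
  have pc: "(\<lambda>x. complex_of_real (p x)) \<in> borel_measurable F"
    "(\<lambda>x. complex_of_real (p x) * h x) \<in> borel_measurable F"
    using p(1) h by measurable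
  have "integrable M (\<lambda>x. complex_of_real (p x) * h x * f x)"
    using p(3) by (simp add: mult.assoc)
  from complex_cond_exp_mult_integrable[OF pc(2) f this]
    complex_cond_exp_mult_integrable[OF pc(1) cond_exp_domain_measurable[OF hf] p(3)] AE_space
  show ?thesis
  proof eventually_elim
    case (elim x)
    then show ?case using p(2)[of x] by (simp add: mult.assoc)
  qed
qed

lemma complex_cond_exp_add:
  assumes f: "f \<in> cond_exp_domain M F" and g: "g \<in> cond_exp_domain M F"
  shows "AE x in M. complex_cond_exp M F (\<lambda>x. f x + g x) x = complex_cond_exp M F f x + complex_cond_exp M F g x"
proof -
  note [measurable] = cond_exp_domain_measurable[OF f] cond_exp_domain_measurable[OF g]
  obtain p :: "'a \<Rightarrow> real" where p: "p \<in> borel_measurable F" "\<And>x. x \<in> space M \<Longrightarrow> 0 < p x"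
    "integrable M (\<lambda>x. complex_of_real (p x) * f x)"
    using cond_exp_domain_weight[OF f] by blast
  obtain r :: "'a \<Rightarrow> real" where r: "r \<in> borel_measurable F" "\<And>x. x \<in> space M \<Longrightarrow> 0 < r x"
    "integrable M (\<lambda>x. complex_of_real (r x) * g x)"
    using cond_exp_domain_weight[OF g] by blast
  define m where "m = (\<lambda>x. complex_of_real (min (p x) (r x)))"
  note [measurable] = p(1) r(1) borel_measurable_F_M[OF p(1)] borel_measurable_F_M[OF r(1)]
  have mF: "m \<in> borel_measurable F" unfolding m_def by measurable
  have [measurable]: "m \<in> borel_measurable M" unfolding m_def by measurable
  have pos: "0 < min (p x) (r x)" if "x \<in> space M" for x using p(2) r(2) that by simp
  have i: "integrable M (\<lambda>x. m x * f x)"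
    by (rule Bochner_Integration.integrable_bound[OF p(3)])
       (use pos p(2) r(2) in \<open>auto simp: m_def norm_mult less_imp_le intro!: mult_right_mono\<close>)
  have j: "integrable M (\<lambda>x. m x * g x)"
    by (rule Bochner_Integration.integrable_bound[OF r(3)])
       (use pos p(2) r(2) in \<open>auto simp: m_def norm_mult less_imp_le intro!: mult_right_mono\<close>)
  have ij: "integrable M (\<lambda>x. m x * (f x + g x))"
    using Bochner_Integration.integrable_add[OF i j] by (simp add: distrib_left)
  have re: "integrable M (\<lambda>x. Re (m x * f x))" "integrable M (\<lambda>x. Re (m x * g x))"
    "integrable M (\<lambda>x. Im (m x * f x))" "integrable M (\<lambda>x. Im (m x * g x))"
    using integrable_Re[OF i] integrable_Re[OF j] integrable_Im[OF i] integrable_Im[OF j] .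
  have "AE x in M. complex_cond_exp M F (\<lambda>x. m x * (f x + g x)) x =
      complex_cond_exp M F (\<lambda>x. m x * f x) x + complex_cond_exp M F (\<lambda>x. m x * g x) x"
    using real_cond_exp_add[OF re(1,2)] real_cond_exp_add[OF re(3,4)]
    by eventually_elim (simp add: complex_cond_exp_def complex_eq_iff distrib_left algebra_simps)
  moreover have "AE x in M. complex_cond_exp M F (\<lambda>x. m x * f x) x = m x * complex_cond_exp M F f x"
    "AE x in M. complex_cond_exp M F (\<lambda>x. m x * g x) x = m x * complex_cond_exp M F g x"
    "AE x in M. complex_cond_exp M F (\<lambda>x. m x * (f x + g x)) x = m x * complex_cond_exp M F (\<lambda>x. f x + g x) x"
    using i j ij by (intro complex_cond_exp_mult_integrable mF; measurable)+
  ultimately show ?thesis using AE_space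
  proof eventually_elim
    case (elim x)
    then have "m x \<noteq> 0" using pos[of x] by (auto simp: m_def)
    moreover have "m x * complex_cond_exp M F (\<lambda>x. f x + g x) x =
        m x * (complex_cond_exp M F f x + complex_cond_exp M F g x)"
      using elim by (simp add: distrib_left)
    ultimately show ?case by simp
  qed
qed

end

section \<open>The operator and its adjoint\<close>

locale weighted_cond_exp = sigma_finite_subalgebra M F for M F :: "'a measure" +
  fixes u :: "'a \<Rightarrow> complex"
  assumes u_domain: "u \<in> cond_exp_domain M F"
    and mult_domain: "\<And>f. f \<in> L2 M \<Longrightarrow> (\<lambda>x. u x * f x) \<in> cond_exp_domain M F"
    and bounded: "bounded_op M (\<lambda>f. complex_cond_exp M F (\<lambda>x. u x * f x))"
begin

abbreviation E :: "('a \<Rightarrow> complex) \<Rightarrow> 'a \<Rightarrow> complex" where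
  "E \<equiv> complex_cond_exp M F"

definition T :: "('a \<Rightarrow> complex) \<Rightarrow> 'a \<Rightarrow> complex" where
  "T = (\<lambda>f. E (\<lambda>x. u x * f x))"

text \<open>
  An explicit form of the adjoint of \<open>T\<close>.
\<close>
definition T_star :: "('a \<Rightarrow> complex) \<Rightarrow> 'a \<Rightarrow> complex" where
  "T_star g = (\<lambda>x. cnj (u x) * E g x)"

lemma u_measurable [measurable]: "u \<in> borel_measurable M"
  using cond_exp_domain_measurable[OF u_domain] .

lemma T_bounded: "bounded_op M T"
  using bounded by (simp add: T_def)

lemma T_L2: "f \<in> L2 M \<Longrightarrow> T f \<in> L2 M"
  using T_bounded by (simp add: bounded_op_def)

lemma T_F_measurable: "T f \<in> borel_measurable F"
  by (simp add: T_def)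

lemma T_star_measurable: "T_star g \<in> borel_measurable M"
  unfolding T_star_def by measurable

text \<open>
  Both sides equal the integral of \<open>E (u h)\<close> times the conjugate of \<open>E g\<close>. The integrability
  hypothesis is kept explicit because membership of \<open>T_star g\<close> in \<open>L2 M\<close> is itself derived from this
  identity, applied to truncations \<open>h\<close> of \<open>T_star g\<close>.
\<close>
lemma T_T_star_duality:
  assumes h: "h \<in> L2 M" and g: "g \<in> L2 M" and int: "integrable M (\<lambda>x. h x * cnj (T_star g x))"
  shows "(\<integral>x. T h x * cnj (g x) \<partial>M) = (\<integral>x. h x * cnj (T_star g x) \<partial>M)"
proof -
  note [measurable] = L2_measurable[OF h] L2_measurable[OF g]
  have Eg: "(\<lambda>x. cnj (E g x)) \<in> borel_measurable F" by measurable
  have eq: "h x * cnj (T_star g x) = cnj (E g x) * (u x * h x)" for x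
    by (simp add: T_star_def)
  have "(\<integral>x. T h x * cnj (g x) \<partial>M) = (\<integral>x. T h x * E (\<lambda>x. cnj (g x)) x \<partial>M)"
    by (rule complex_cond_exp_intg[OF T_F_measurable _ L2_mult_integrable[OF T_L2[OF h] L2_cnj[OF g]], symmetric])
       measurable
  also have "\<dots> = (\<integral>x. cnj (E g x) * E (\<lambda>x. u x * h x) x \<partial>M)"
    by (simp add: complex_cond_exp_cnj T_def mult.commute)
  also have "\<dots> = (\<integral>x. cnj (E g x) * (u x * h x) \<partial>M)"
    by (rule complex_cond_exp_intg[OF Eg]) (use int in \<open>simp_all only: eq, measurable\<close>)
  finally show ?thesis by (simp only: eq)
qed

text \<open>
  Pairing \<open>T_star g\<close> with its truncation \<open>h\<close> gives \<open>\<parallel>h\<parallel>\<^sup>2\<close>, and by duality this is the pairing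
  of \<open>T h\<close> with \<open>g\<close>. Young's inequality with the weight \<open>C\<close> bounds it by
  \<open>\<parallel>h\<parallel>\<^sup>2 / 2 + C \<parallel>g\<parallel>\<^sup>2 / 2\<close>, and the first term can be absorbed because \<open>\<parallel>h\<parallel>\<close> is finite.
\<close>
lemma T_star_truncation_bound:
  assumes C: "C \<ge> 1"
    "\<And>f. f \<in> L2 M \<Longrightarrow> (\<integral>x. (cmod (T f x))\<^sup>2 \<partial>M) \<le> C * (\<integral>x. (cmod (f x))\<^sup>2 \<partial>M)"
    and g: "g \<in> L2 M" and B [measurable]: "B \<in> sets M" and h: "(\<lambda>x. indicator B x * T_star g x) \<in> L2 M"
  shows "(\<integral>x. (cmod (indicator B x * T_star g x))\<^sup>2 \<partial>M) \<le> C * (\<integral>x. (cmod (g x))\<^sup>2 \<partial>M)"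
proof -
  let ?h = "\<lambda>x. indicator B x * T_star g x"
  have sq: "?h x * cnj (T_star g x) = complex_of_real ((cmod (?h x))\<^sup>2)" for x
    by (simp only: complex_norm_square) (simp split: split_indicator)
  have int: "integrable M (\<lambda>x. ?h x * cnj (T_star g x))"
    unfolding sq using L2_integrable[OF h] by (rule integrable_of_real)
  have i: "integrable M (\<lambda>x. (cmod (T ?h x))\<^sup>2 / (2 * C) + C / 2 * (cmod (g x))\<^sup>2)"
    using L2_integrable[OF T_L2[OF h]] L2_integrable[OF g] by auto
  have young: "cmod (T ?h x * cnj (g x)) \<le> (cmod (T ?h x))\<^sup>2 / (2 * C) + C / 2 * (cmod (g x))\<^sup>2" for x
  proof -
    have "0 \<le> (cmod (T ?h x) - C * cmod (g x))\<^sup>2 / (2 * C)" using C(1) by simp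
    also have "\<dots> = (cmod (T ?h x))\<^sup>2 / (2 * C) + C / 2 * (cmod (g x))\<^sup>2 - cmod (T ?h x) * cmod (g x)"
      using C(1) by (simp add: power2_diff field_simps power2_eq_square)
    finally show ?thesis by (simp add: norm_mult)
  qed
  have "complex_of_real (\<integral>x. (cmod (?h x))\<^sup>2 \<partial>M) = (\<integral>x. T ?h x * cnj (g x) \<partial>M)"
    unfolding T_T_star_duality[OF h g int] sq by (rule integral_complex_of_real[symmetric])
  moreover have "0 \<le> (\<integral>x. (cmod (?h x))\<^sup>2 \<partial>M)" by simp
  ultimately have "(\<integral>x. (cmod (?h x))\<^sup>2 \<partial>M) = cmod (\<integral>x. T ?h x * cnj (g x) \<partial>M)"
    by (simp only: norm_of_real abs_of_nonneg flip: \<open>complex_of_real _ = _\<close>)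
  also have "\<dots> \<le> (\<integral>x. cmod (T ?h x * cnj (g x)) \<partial>M)"
    by (rule integral_norm_bound)
  also have "\<dots> \<le> (\<integral>x. (cmod (T ?h x))\<^sup>2 / (2 * C) + C / 2 * (cmod (g x))\<^sup>2 \<partial>M)"
    by (intro integral_mono i young integrable_norm L2_mult_integrable T_L2 h L2_cnj g)
  also have "\<dots> = (\<integral>x. (cmod (T ?h x))\<^sup>2 \<partial>M) / (2 * C) + C / 2 * (\<integral>x. (cmod (g x))\<^sup>2 \<partial>M)"
    using L2_integrable[OF T_L2[OF h]] L2_integrable[OF g] by simp
  also have "\<dots> \<le> (C * (\<integral>x. (cmod (?h x))\<^sup>2 \<partial>M)) / (2 * C) + C / 2 * (\<integral>x. (cmod (g x))\<^sup>2 \<partial>M)"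
    using C(1) C(2)[OF h] by (intro add_right_mono divide_right_mono) auto
  also have "\<dots> = (\<integral>x. (cmod (?h x))\<^sup>2 \<partial>M) / 2 + C / 2 * (\<integral>x. (cmod (g x))\<^sup>2 \<partial>M)"
    using C(1) by simp
  finally show ?thesis by simp
qed

text \<open>
  The truncations to the sets \<open>B n\<close>, where \<open>T_star g\<close> is bounded and the measure is finite, are
  square-integrable with a common bound; monotone convergence removes the truncation.
\<close>
lemma T_star_L2_bound:
  assumes C: "C \<ge> 1"
    "\<And>f. f \<in> L2 M \<Longrightarrow> (\<integral>x. (cmod (T f x))\<^sup>2 \<partial>M) \<le> C * (\<integral>x. (cmod (f x))\<^sup>2 \<partial>M)"
    and g: "g \<in> L2 M"
  shows "T_star g \<in> L2 M" "(\<integral>x. (cmod (T_star g x))\<^sup>2 \<partial>M) \<le> C * (\<integral>x. (cmod (g x))\<^sup>2 \<partial>M)"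
proof -
  note [measurable] = T_star_measurable
  obtain A :: "nat \<Rightarrow> 'a set" where A: "range A \<subseteq> sets M" "(\<Union>i. A i) = space M"
    "\<And>i. emeasure M (A i) \<noteq> \<infinity>" "incseq A"
    using sigma_finite_incseq by blast
  define B where "B n = {x \<in> A n. cmod (T_star g x) \<le> real n}" for n
  have [measurable]: "A n \<in> sets M" for n using A(1) by auto
  have B [measurable]: "B n \<in> sets M" for n unfolding B_def by measurable
  let ?h = "\<lambda>n x. indicator (B n) x * T_star g x"
  have h: "?h n \<in> L2 M" for n
  proof (rule L2_I)
    have "integrable M (\<lambda>x. (real n)\<^sup>2 * indicator (A n) x)"
      using A(3)[of n] by (intro integrable_mult_right integrable_real_indicator) (auto simp: less_top)
    then show "integrable M (\<lambda>x. (cmod (?h n x))\<^sup>2)"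
      by (rule Bochner_Integration.integrable_bound)
         (auto simp: B_def norm_mult intro!: power_mono split: split_indicator)
  qed measurable
  let ?K = "C * (\<integral>x. (cmod (g x))\<^sup>2 \<partial>M)"
  have K: "0 \<le> ?K" using C(1) by simp
  have "(\<integral>\<^sup>+x. ennreal ((cmod (T_star g x))\<^sup>2) \<partial>M) = (\<integral>\<^sup>+x. (SUP n. ennreal ((cmod (?h n x))\<^sup>2)) \<partial>M)"
  proof (rule nn_integral_cong)
    fix x assume "x \<in> space M"
    then obtain i where i: "x \<in> A i" using A(2) by auto
    define n where "n = max i (nat \<lceil>cmod (T_star g x)\<rceil>)"
    have "x \<in> A n" using i incseqD[OF A(4), of i n] by (auto simp: n_def)
    moreover have "cmod (T_star g x) \<le> real n" unfolding n_def by linarith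
    ultimately have "x \<in> B n" by (simp add: B_def)
    then show "ennreal ((cmod (T_star g x))\<^sup>2) = (SUP n. ennreal ((cmod (?h n x))\<^sup>2))"
      by (intro antisym SUP_upper2[of n] SUP_least) (auto split: split_indicator)
  qed
  also have "\<dots> = (SUP n. (\<integral>\<^sup>+x. ennreal ((cmod (?h n x))\<^sup>2) \<partial>M))"
  proof (rule nn_integral_monotone_convergence_SUP)
    have "B m \<subseteq> B n" if "m \<le> n" for m n
      using incseqD[OF A(4) that] that by (auto simp: B_def intro: order_trans)
    then show "incseq (\<lambda>n x. ennreal ((cmod (?h n x))\<^sup>2))"
      by (auto simp: incseq_def le_fun_def split: split_indicator)
  qed measurable
  also have "\<dots> \<le> ennreal ?K"
  proof (rule SUP_least)
    fix n
    have "(\<integral>\<^sup>+x. ennreal ((cmod (?h n x))\<^sup>2) \<partial>M) = ennreal (\<integral>x. (cmod (?h n x))\<^sup>2 \<partial>M)"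
      by (rule nn_integral_eq_integral[OF L2_integrable[OF h]]) simp
    then show "(\<integral>\<^sup>+x. ennreal ((cmod (?h n x))\<^sup>2) \<partial>M) \<le> ennreal ?K"
      using T_star_truncation_bound[OF C g B h] by (simp add: ennreal_leI)
  qed
  finally have *: "(\<integral>\<^sup>+x. ennreal ((cmod (T_star g x))\<^sup>2) \<partial>M) \<le> ennreal ?K" .
  have int: "integrable M (\<lambda>x. (cmod (T_star g x))\<^sup>2)"
    using le_less_trans[OF * ennreal_less_top] by (simp add: integrable_iff_bounded)
  then show "T_star g \<in> L2 M" by (intro L2_I T_star_measurable)
  show "(\<integral>x. (cmod (T_star g x))\<^sup>2 \<partial>M) \<le> ?K"
    using * K by (simp add: nn_integral_eq_integral[OF int])
qed

lemma T_star_is_adjoint: "is_adjoint M T T_star"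
proof -
  obtain C where C: "C \<ge> 1"
    "\<And>f. f \<in> L2 M \<Longrightarrow> (\<integral>x. (cmod (T f x))\<^sup>2 \<partial>M) \<le> C * (\<integral>x. (cmod (f x))\<^sup>2 \<partial>M)"
    using bounded_op_integral_bound[OF T_bounded] by blast
  have L: "T_star g \<in> L2 M" if "g \<in> L2 M" for g using T_star_L2_bound(1)[OF C that] .
  have add: "ae_eq M (T_star (\<lambda>x. f x + g x)) (\<lambda>x. T_star f x + T_star g x)" if "f \<in> L2 M" "g \<in> L2 M" for f g
    using complex_cond_exp_add[OF that[THEN L2_cond_exp_domain]]
    unfolding ae_eq_def by eventually_elim (simp add: T_star_def distrib_left)
  have scale: "ae_eq M (T_star (\<lambda>x. c * f x)) (\<lambda>x. c * T_star f x)" if f: "f \<in> L2 M" for c f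
  proof -
    have "(\<lambda>x. c * f x) \<in> L2 M"
      using f by (auto simp: L2_def norm_mult power_mult_distrib)
    from complex_cond_exp_mult[OF _ L2_measurable[OF f] L2_cond_exp_domain[OF this]]
    show ?thesis unfolding ae_eq_def by (auto simp: T_star_def)
  qed
  have "L2_norm M (T_star g) \<le> sqrt C * L2_norm M g" if "g \<in> L2 M" for g
    using T_star_L2_bound(2)[OF C that] by (simp add: L2_norm_def real_sqrt_mult[symmetric])
  then have "bounded_op M T_star"
    using L add scale by (auto simp: bounded_op_def)
  moreover have "L2_inner M (T f) g = L2_inner M f (T_star g)" if "f \<in> L2 M" "g \<in> L2 M" for f g
    unfolding L2_inner_def by (intro T_T_star_duality L2_mult_integrable L2_cnj L that)
  ultimately show ?thesis by (simp add: is_adjoint_def)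
qed

lemma T_star_L2: "g \<in> L2 M \<Longrightarrow> T_star g \<in> L2 M"
  using T_star_is_adjoint by (simp add: is_adjoint_def bounded_op_def)

lemma adj_is_adjoint: "is_adjoint M T (adj M T)"
  unfolding adj_def by (rule someI[of _ T_star]) (rule T_star_is_adjoint)

lemma adj_L2: "g \<in> L2 M \<Longrightarrow> adj M T g \<in> L2 M"
  using adj_is_adjoint by (simp add: is_adjoint_def bounded_op_def)

lemma adj_AE: "g \<in> L2 M \<Longrightarrow> AE x in M. adj M T g x = cnj (u x) * E g x"
  using adjoint_unique[OF adj_is_adjoint T_star_is_adjoint] by (simp add: T_star_def)

section \<open>Products of the operator and its adjoint\<close>

abbreviation E_abs_sq :: "'a \<Rightarrow> complex" where
  "E_abs_sq \<equiv> E (\<lambda>x. u x * cnj (u x))"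

lemma T_AE_cong:
  assumes "f \<in> L2 M" "g \<in> L2 M" "AE x in M. f x = g x"
  shows "AE x in M. T f x = T g x"
  using bounded_op_respecting[OF T_bounded] assms by (simp add: L2_respecting_def)

lemma T_of_F_measurable:
  assumes f: "f \<in> L2 M" "f \<in> borel_measurable F"
  shows "AE x in M. T f x = f x * E u x"
  using complex_cond_exp_mult[OF f(2) u_measurable] mult_domain[OF f(1)]
  by (simp add: T_def mult.commute)

lemma E_T: "AE x in M. E (T f) x = T f x"
  by (rule complex_cond_exp_F_meas[OF T_F_measurable])

text \<open>
  Since \<open>E g\<close> is measurable with respect to \<open>F\<close>, it can be pulled out of
  \<open>E (u \<cdot> cnj u \<cdot> E g)\<close>.
\<close>
lemma T_adj:
  assumes g: "g \<in> L2 M"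
  shows "AE x in M. T (adj M T g) x = E g x * E_abs_sq x"
proof -
  have eq: "u x * T_star g x = E g x * (u x * cnj (u x))" for x by (simp add: T_star_def)
  have "AE x in M. T (T_star g) x = E g x * E_abs_sq x"
    unfolding T_def eq using mult_domain[OF T_star_L2[OF g], unfolded eq]
    by (intro complex_cond_exp_mult) auto
  moreover have "AE x in M. T (adj M T g) x = T (T_star g) x"
    using adj_AE[OF g] by (intro T_AE_cong adj_L2 T_star_L2 g) (simp add: T_star_def)
  ultimately show ?thesis by eventually_elim simp
qed

lemma E_adj:
  assumes g: "g \<in> L2 M"
  shows "AE x in M. E (adj M T g) x = E g x * cnj (E u x)"
proof -
  have eq: "T_star g x = E g x * cnj (u x)" for x by (simp add: T_star_def)
  have "AE x in M. E (\<lambda>x. E g x * cnj (u x)) x = E g x * E (\<lambda>x. cnj (u x)) x"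
    using L2_cond_exp_domain[OF T_star_L2[OF g]]
    by (intro complex_cond_exp_mult) (auto simp: T_star_def mult.commute)
  moreover have "AE x in M. E (adj M T g) x = E (\<lambda>x. E g x * cnj (u x)) x"
    using adj_AE[OF g] by (intro complex_cond_exp_cong) (auto simp: mult.commute intro: L2_measurable[OF adj_L2[OF g]])
  ultimately show ?thesis by eventually_elim (simp add: complex_cond_exp_cnj)
qed

text \<open>
  The values of \<open>T\<close> are measurable with respect to \<open>F\<close>, so the second application of \<open>T\<close>
  multiplies by \<open>E u\<close>, while the final adjoint contributes the factor \<open>cnj u\<close> outside of any
  conditional expectation.
\<close>
lemma adj_T_T_adj:
  assumes q: "q \<in> L2 M"
  shows "AE x in M. adj M T (T (T (adj M T q))) x = cnj (u x) * (E q x * E_abs_sq x * E u x)"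
proof -
  have L: "T (adj M T q) \<in> L2 M" by (intro T_L2 adj_L2 q)
  show ?thesis
    using adj_AE[OF T_L2[OF L]] E_T[of "T (adj M T q)"] T_of_F_measurable[OF L T_F_measurable] T_adj[OF q]
    by eventually_elim simp
qed

text \<open>
  In contrast to the product in the other order, the outermost operator is \<open>T\<close>, so every occurrence
  of \<open>u\<close> is averaged.
\<close>
lemma T_adj_adj_T:
  assumes q: "q \<in> L2 M" "q \<in> borel_measurable F"
  shows "AE x in M. T (adj M T (adj M T (T q))) x = q x * E u x * cnj (E u x) * E_abs_sq x"
  using T_adj[OF adj_L2[OF T_L2[OF q(1)]]] E_adj[OF T_L2[OF q(1)]] E_T[of q] T_of_F_measurable[OF q]
  by eventually_elim simp

section \<open>Centered weighted conditional expectations\<close>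

lemma positive_L2_F_measurable:
  obtains q :: "'a \<Rightarrow> complex" where "q \<in> L2 M" "q \<in> borel_measurable F" "\<And>x. x \<in> space M \<Longrightarrow> q x \<noteq> 0"
proof -
  obtain r :: "'a \<Rightarrow> real" where r: "r \<in> borel_measurable F" "integrable M r" "\<And>x. x \<in> space M \<Longrightarrow> 0 < r x"
    using positive_integrable_F_measurable by blast
  define q where "q = (\<lambda>x. complex_of_real (sqrt (r x)))"
  have qF: "q \<in> borel_measurable F" using r(1) unfolding q_def by measurable
  have "integrable M (\<lambda>x. (cmod (q x))\<^sup>2)"
    using r(2) by (rule Bochner_Integration.integrable_cong[THEN iffD1, rotated 2])
      (auto simp: q_def less_imp_le[OF r(3)])
  then have "q \<in> L2 M" using borel_measurable_F_M[OF qF] by (rule L2_I[rotated])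
  moreover have "q x \<noteq> 0" if "x \<in> space M" for x using r(3)[OF that] by (simp add: q_def)
  ultimately show ?thesis using that qF by blast
qed

text \<open>
  For a nowhere vanishing \<open>q\<close> that is measurable with respect to \<open>F\<close>, the function
  \<open>u \<cdot> T_star q = q |u|\<^sup>2\<close> lies in the domain of the conditional expectation, and \<open>|q|\<close> can be
  pulled out.
\<close>
lemma cond_exp_sq_finite:
  "AE x in M. nn_cond_exp M F (\<lambda>x. ennreal ((cmod (u x))\<^sup>2)) x < \<infinity>"
proof -
  let ?w = "nn_cond_exp M F (\<lambda>x. ennreal ((cmod (u x))\<^sup>2))"
  obtain q where q: "q \<in> L2 M" "q \<in> borel_measurable F" "\<And>x. x \<in> space M \<Longrightarrow> q x \<noteq> 0"
    using positive_L2_F_measurable by blast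
  have eq: "ennreal (cmod (u x * T_star q x)) = ennreal (cmod (E q x)) * ennreal ((cmod (u x))\<^sup>2)" for x
    by (simp add: T_star_def norm_mult power2_eq_square ennreal_mult[symmetric] ac_simps)
  have "AE x in M. nn_cond_exp M F (\<lambda>x. ennreal (cmod (u x * T_star q x))) x < \<infinity>"
    using mult_domain[OF T_star_L2[OF q(1)]] by (simp add: cond_exp_domain_def)
  moreover have "AE x in M. ennreal (cmod (E q x)) * ?w x = nn_cond_exp M F (\<lambda>x. ennreal (cmod (u x * T_star q x))) x"
    unfolding eq by (intro nn_cond_exp_prod) measurable
  ultimately show ?thesis using complex_cond_exp_F_meas[OF q(2)] AE_space
  proof eventually_elim
    case (elim x)
    then have "cmod (E q x) > 0" using q(3) by simp
    moreover have "ennreal (cmod (E q x)) * ?w x \<noteq> top" using elim(1,2) by simp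
    ultimately show ?case by (auto simp: ennreal_mult_eq_top_iff less_top)
  qed
qed

text \<open>
  Links the complex conditional expectation that occurs in the operator identities to the
  nonnegative one that occurs in the hypothesis on supports.
\<close>
lemma E_abs_sq_eq_nn_cond_exp:
  "AE x in M. E_abs_sq x = of_real (enn2real (nn_cond_exp M F (\<lambda>x. ennreal ((cmod (u x))\<^sup>2)) x))"
proof -
  have r: "Re (u x * cnj (u x)) = (cmod (u x))\<^sup>2" "Im (u x * cnj (u x)) = 0" for x
    by (simp_all add: complex_norm_square[symmetric] del: complex_cnj_mult)
  have z: "ennreal (- (cmod (u x))\<^sup>2) = 0" for x by (simp add: ennreal_neg)
  have "AE x in M. 0 = nn_cond_exp M F (\<lambda>_. 0) x"
    by (intro nn_cond_exp_F_meas) simp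
  then show ?thesis
    by eventually_elim
       (simp add: complex_cond_exp_def r real_cond_exp_def z complex_eq_iff del: complex_cnj_mult times_complex.sel)
qed

text \<open>
  The set where the conditional expectation of \<open>|u|\<^sup>2\<close> vanishes is measurable with respect to \<open>F\<close>,
  so \<open>|u|\<^sup>2\<close> has the same integral over it, namely zero.
\<close>
lemma zero_where_cond_exp_sq_zero:
  "AE x in M. nn_cond_exp M F (\<lambda>x. ennreal ((cmod (u x))\<^sup>2)) x = 0 \<longrightarrow> u x = 0"
proof -
  let ?s = "\<lambda>x. ennreal ((cmod (u x))\<^sup>2)"
  let ?w = "nn_cond_exp M F ?s"
  let ?i = "\<lambda>x. if ?w x = 0 then 1 else 0 :: ennreal"
  have "(\<integral>\<^sup>+x. ?i x * ?s x \<partial>M) = (\<integral>\<^sup>+x. ?i x * ?w x \<partial>M)"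
    by (rule nn_cond_exp_intg[symmetric]) measurable
  also have "\<dots> = (\<integral>\<^sup>+x. 0 \<partial>M)" by (intro nn_integral_cong) auto
  finally have "(\<integral>\<^sup>+x. ?i x * ?s x \<partial>M) = 0" by simp
  then have "AE x in M. ?i x * ?s x = 0"
    by (subst (asm) nn_integral_0_iff_AE) auto
  then show ?thesis by eventually_elim auto
qed

text \<open>
  At a nowhere vanishing \<open>q\<close> that is measurable with respect to \<open>F\<close>, the two products evaluate to
  \<open>cnj u\<close> and \<open>cnj (E u)\<close>, each times the common factor \<open>q \<cdot> E|u|\<^sup>2 \<cdot> E u\<close>. By the hypothesis on
  supports this factor is nonzero wherever \<open>E u\<close> is, so \<open>u = E u\<close> there. Elsewhere
  \<open>E|u|\<^sup>2\<close> vanishes too, and hence so does \<open>u\<close>.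
\<close>
lemma commuting_imp_F_measurable:
  assumes comm: "op_eq M ((adj M T \<circ> T) \<circ> (T \<circ> adj M T)) ((T \<circ> adj M T) \<circ> (adj M T \<circ> T))"
    and supp: "ae_eq_set M (supp M (E u)) (supp M (nn_cond_exp M F (\<lambda>x. ennreal ((cmod (u x))\<^sup>2))))"
  shows "AE x in M. u x = E u x"
proof -
  obtain q where q: "q \<in> L2 M" "q \<in> borel_measurable F" "\<And>x. x \<in> space M \<Longrightarrow> q x \<noteq> 0"
    using positive_L2_F_measurable by blast
  have "AE x in M. adj M T (T (T (adj M T q))) x = T (adj M T (adj M T (T q))) x"
    using comm q(1) by (simp add: op_eq_def ae_eq_def)
  with adj_T_T_adj[OF q(1)] T_adj_adj_T[OF q(1,2)] complex_cond_exp_F_meas[OF q(2)]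
    zero_where_cond_exp_sq_zero E_abs_sq_eq_nn_cond_exp cond_exp_sq_finite supp[unfolded ae_eq_set_def] AE_space
  show ?thesis
  proof eventually_elim
    case (elim x)
    show ?case
    proof (cases "E u x = 0")
      case True
      then show ?thesis using elim(4,7,8) by (simp add: supp_def)
    next
      case False
      then have "nn_cond_exp M F (\<lambda>x. ennreal ((cmod (u x))\<^sup>2)) x \<noteq> 0"
        using elim(7,8) by (simp add: supp_def)
      then have "E_abs_sq x \<noteq> 0" using elim(5,6) by (auto simp: enn2real_eq_0_iff)
      moreover have "cnj (u x) * (q x * E_abs_sq x * E u x) = cnj (E u x) * (q x * E_abs_sq x * E u x)"
        using elim(1-3,9) by (auto simp: ac_simps)
      ultimately show ?thesis using False q(3)[OF elim(8)] by simp
    qed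
  qed
qed

text \<open>
  On functions that are measurable with respect to \<open>F\<close>, the operator is multiplication by \<open>E u\<close>.
  If \<open>|E u|\<^sup>2 > C\<close> on a set of positive measure, restricting a nowhere vanishing \<open>q\<close> to that set
  would contradict the bound \<open>C\<close> on the square of the norm.
\<close>
lemma E_u_bounded: "\<exists>C. AE x in M. cmod (E u x) \<le> C"
proof -
  obtain C where C: "C \<ge> 1"
    "\<And>f. f \<in> L2 M \<Longrightarrow> (\<integral>x. (cmod (T f x))\<^sup>2 \<partial>M) \<le> C * (\<integral>x. (cmod (f x))\<^sup>2 \<partial>M)"
    using bounded_op_integral_bound[OF T_bounded] by blast
  obtain q where q: "q \<in> L2 M" "q \<in> borel_measurable F" "\<And>x. x \<in> space M \<Longrightarrow> q x \<noteq> 0"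
    using positive_L2_F_measurable by blast
  note [measurable] = q(2) borel_measurable_F_M[OF q(2)]
  \<comment> \<open>a test function supported exactly where the claimed bound fails\<close>
  define f where "f = (\<lambda>x. if (cmod (E u x))\<^sup>2 > C then q x else 0)"
  have fF: "f \<in> borel_measurable F" unfolding f_def by measurable
  have f: "f \<in> L2 M" by (rule L2_bound[OF borel_measurable_F_M[OF fF] q(1)]) (simp add: f_def)
  define d where "d = (\<lambda>x. (cmod (T f x))\<^sup>2 - C * (cmod (f x))\<^sup>2)"
  have d: "AE x in M. d x = ((cmod (E u x))\<^sup>2 - C) * (cmod (f x))\<^sup>2"
    using T_of_F_measurable[OF f fF]
    by eventually_elim (simp add: d_def norm_mult power_mult_distrib algebra_simps)
  have pos: "AE x in M. 0 \<le> d x"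
    using d by eventually_elim (auto simp: f_def)
  have int: "integrable M d"
    unfolding d_def using L2_integrable[OF f] L2_integrable[OF T_L2[OF f]] by simp
  have "(\<integral>x. d x \<partial>M) \<le> 0"
    unfolding d_def using C(2)[OF f] L2_integrable[OF f] L2_integrable[OF T_L2[OF f]] by simp
  then have "(\<integral>x. d x \<partial>M) = 0" using integral_nonneg_AE[OF pos] by simp
  then have "AE x in M. d x = 0" using integral_nonneg_eq_0_iff_AE[OF int pos] by simp
  with d AE_space have "AE x in M. cmod (E u x) \<le> sqrt C"
  proof eventually_elim
    case (elim x)
    then have "(cmod (E u x))\<^sup>2 \<le> C" using q(3)[of x] by (auto simp: f_def split: if_splits)
    then show ?case by (rule real_le_rsqrt)
  qed
  then show ?thesis by blast
qed

text \<open>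
  Both products are \<open>f \<mapsto> |v|\<^sup>2 \<cdot> E f\<close>.
\<close>
lemma F_measurable_imp_normal:
  assumes v: "v \<in> borel_measurable F" and uv: "AE x in M. u x = v x"
  shows "normal_op M T"
proof -
  note [measurable] = v borel_measurable_F_M[OF v]
  have "AE x in M. E_abs_sq x = E (\<lambda>x. v x * cnj (v x)) x"
    using uv by (intro complex_cond_exp_cong) auto
  moreover have "AE x in M. E (\<lambda>x. v x * cnj (v x)) x = v x * cnj (v x)"
    by (intro complex_cond_exp_F_meas) measurable
  ultimately have E_abs_sq: "AE x in M. E_abs_sq x = v x * cnj (v x)" by eventually_elim simp
  have "AE x in M. adj M T (T f) x = T (adj M T f) x" if f: "f \<in> L2 M" for f
  proof -
    note [measurable] = L2_measurable[OF f]
    have vf: "(\<lambda>x. v x * f x) \<in> cond_exp_domain M F"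
      by (rule cond_exp_domain_bound[OF mult_domain[OF f]]) (use uv in auto)
    have "AE x in M. T f x = E (\<lambda>x. v x * f x) x"
      unfolding T_def using uv by (intro complex_cond_exp_cong) auto
    with complex_cond_exp_mult[OF v L2_measurable[OF f] vf] adj_AE[OF T_L2[OF f]] E_T[of f] T_adj[OF f] E_abs_sq uv
    show ?thesis by eventually_elim simp
  qed
  then show ?thesis using T_bounded by (simp add: normal_op_def op_eq_def ae_eq_def)
qed

end

theorem corollary2p11:
  fixes M F :: "'a measure" and u :: "'a \<Rightarrow> complex"
    and T :: "('a \<Rightarrow> complex) \<Rightarrow> ('a \<Rightarrow> complex)"
  assumes "complete_measure M"
    and "sigma_finite_measure M"
    and "sigma_finite_subalgebra M F"
    and "u \<in> cond_exp_domain M F"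
    and "\<forall>f\<in>L2 M. (\<lambda>x. u x * f x) \<in> cond_exp_domain M F"
    and T_def: "T = (\<lambda>f. complex_cond_exp M F (\<lambda>x. u x * f x))"
    and "bounded_op M T"
    and "ae_eq_set M (supp M (complex_cond_exp M F u))
           (supp M (nn_cond_exp M F (\<lambda>x. ennreal ((cmod (u x))\<^sup>2))))"
  shows "(centered_op M T \<longleftrightarrow> normal_op M T) \<and>
         (normal_op M T \<longleftrightarrow> (\<exists>v\<in>Linf (restr_to_subalg M F). ae_eq M u v))"
proof -
  interpret sub: sigma_finite_subalgebra M F by fact
  interpret op: weighted_cond_exp M F u
    using assms(4,5,7) unfolding T_def by unfold_locales auto
  have T: "T = op.T" by (simp add: T_def op.T_def)
  have 1: "\<exists>v\<in>Linf (restr_to_subalg M F). ae_eq M u v" if cent: "centered_op M T"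
  proof -
    let ?T_star = "adj M T" and ?a = "complex_cond_exp M F u"
    \<comment> \<open>the exponent one turns these members of the family into \<open>T\<^sup>* T\<close> and \<open>T T\<^sup>*\<close>\<close>
    have "(?T_star ^^ 1) \<circ> (T ^^ 1) \<in> centered_family M T" "(T ^^ 1) \<circ> (?T_star ^^ 1) \<in> centered_family M T"
      unfolding centered_family_def by blast+
    then have "op_eq M ((?T_star \<circ> T) \<circ> (T \<circ> ?T_star)) ((T \<circ> ?T_star) \<circ> (?T_star \<circ> T))"
      using cent by (simp add: centered_op_def)
    then have "AE x in M. u x = ?a x"
      unfolding T by (rule op.commuting_imp_F_measurable) fact
    moreover obtain C where "AE x in M. cmod (?a x) \<le> C" using op.E_u_bounded by blast
    then have "AE x in restr_to_subalg M F. cmod (?a x) \<le> C"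
      by (rule AE_restr_to_subalg2[OF sub.subalg]) measurable
    then have "?a \<in> Linf (restr_to_subalg M F)"
      using measurable_in_subalg[OF sub.subalg sub.complex_cond_exp_measurable(1)]
      by (auto simp: Linf_def)
    ultimately show ?thesis by (auto simp: ae_eq_def)
  qed
  have 2: "normal_op M T" if "\<exists>v\<in>Linf (restr_to_subalg M F). ae_eq M u v"
  proof -
    obtain v where v: "v \<in> Linf (restr_to_subalg M F)" "AE x in M. u x = v x"
      using \<open>\<exists>v\<in>_. _\<close> by (auto simp: ae_eq_def)
    have "v \<in> borel_measurable F"
      by (rule measurable_in_subalg'[OF sub.subalg]) (use v(1) in \<open>simp add: Linf_def\<close>)
    then show ?thesis unfolding T by (rule op.F_measurable_imp_normal[OF _ v(2)])
  qed
  have 3: "centered_op M T" if "normal_op M T"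
    using normal_op_centered[OF op.T_bounded op.adj_is_adjoint] that by (simp add: T)
  show ?thesis using 1 2 3 by blast
qed

end
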